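(* Let $m = 2q$, where $q = q_1 \cdots q_n$ is a product of distinct primes $q_j$ with each $q_j \equiv 1$ or $3 \pmod 8$, and $q \equiv 3 \pmod 8$. Then over the real quadratic field $K=\mathbb{Q}(\sqrt{m})$ there exists an elliptic curve $E/K$ with everywhere good reduction; moreover such an $E$ can be chosen with $j(E) = 20^3$.
   Context: An elliptic curve $E/K$ has everywhere good reduction if it has good reduction at every prime of $\mathcal{O}_K$. *)

theory Defs
  imports Complex_Main "HOL-Computational_Algebra.Computational_Algebra"
begin

definition quad_field :: "nat \<Rightarrow> real set" where
  "quad_field m = {of_rat a + of_rat b * sqrt (real m) | a b. True}"

definition ring_of_integers :: "real set \<Rightarrow> real set" where
  "ring_of_integers K =
     {x \<in> K. \<exists>p :: int poly. lead_coeff p = 1 \<and> poly (map_poly of_int p) x = 0}"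

definition nonzero_prime_ideal :: "real set \<Rightarrow> real set \<Rightarrow> bool" where
  "nonzero_prime_ideal R P \<longleftrightarrow>
     P \<subseteq> R \<and> 0 \<in> P \<and> (\<forall>x\<in>P. \<forall>y\<in>P. x + y \<in> P \<and> - x \<in> P) \<and>
     (\<forall>a\<in>R. \<forall>x\<in>P. a * x \<in> P) \<and>
     P \<noteq> {0} \<and> P \<noteq> R \<and>
     (\<forall>a\<in>R. \<forall>b\<in>R. a * b \<in> P \<longrightarrow> a \<in> P \<or> b \<in> P)"

definition localization :: "real set \<Rightarrow> real set \<Rightarrow> real set" where
  "localization R P = {a / b | a b. a \<in> R \<and> b \<in> R \<and> b \<notin> P}"

text \<open>Weierstrass equations y^2 + a1 xy + a3 y = x^3 + a2 x^2 + a4 x + a6.\<close>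
datatype weq = Weq (wa1: real) (wa2: real) (wa3: real) (wa4: real) (wa6: real)

definition wb2 :: "weq \<Rightarrow> real" where "wb2 E = wa1 E ^ 2 + 4 * wa2 E"
definition wb4 :: "weq \<Rightarrow> real" where "wb4 E = 2 * wa4 E + wa1 E * wa3 E"
definition wb6 :: "weq \<Rightarrow> real" where "wb6 E = wa3 E ^ 2 + 4 * wa6 E"
definition wb8 :: "weq \<Rightarrow> real" where
  "wb8 E = wa1 E ^ 2 * wa6 E + 4 * wa2 E * wa6 E - wa1 E * wa3 E * wa4 E
           + wa2 E * wa3 E ^ 2 - wa4 E ^ 2"
definition wdisc :: "weq \<Rightarrow> real" where
  "wdisc E = - (wb2 E ^ 2) * wb8 E - 8 * wb4 E ^ 3 - 27 * wb6 E ^ 2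
             + 9 * wb2 E * wb4 E * wb6 E"
definition wc4 :: "weq \<Rightarrow> real" where "wc4 E = wb2 E ^ 2 - 24 * wb4 E"
definition j_invariant :: "weq \<Rightarrow> real" where "j_invariant E = wc4 E ^ 3 / wdisc E"

definition coeffs_in :: "weq \<Rightarrow> real set \<Rightarrow> bool" where
  "coeffs_in E S \<longleftrightarrow> wa1 E \<in> S \<and> wa2 E \<in> S \<and> wa3 E \<in> S \<and> wa4 E \<in> S \<and> wa6 E \<in> S"

definition elliptic_curve_over :: "real set \<Rightarrow> weq \<Rightarrow> bool" where
  "elliptic_curve_over K E \<longleftrightarrow> coeffs_in E K \<and> wdisc E \<noteq> 0"

text \<open>Standard change of variables x = u^2 x' + r, y = u^3 y' + s u^2 x' + t (Silverman III.1).\<close>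
definition isomorphic_over :: "real set \<Rightarrow> weq \<Rightarrow> weq \<Rightarrow> bool" where
  "isomorphic_over K E E' \<longleftrightarrow> (\<exists>u\<in>K. \<exists>r\<in>K. \<exists>s\<in>K. \<exists>t\<in>K. u \<noteq> 0 \<and>
     u * wa1 E' = wa1 E + 2 * s \<and>
     u ^ 2 * wa2 E' = wa2 E - s * wa1 E + 3 * r - s ^ 2 \<and>
     u ^ 3 * wa3 E' = wa3 E + r * wa1 E + 2 * t \<and>
     u ^ 4 * wa4 E' = wa4 E - s * wa3 E + 2 * r * wa2 E - (t + r * s) * wa1 E
                       + 3 * r ^ 2 - 2 * s * t \<and>
     u ^ 6 * wa6 E' = wa6 E + r * wa4 E + r ^ 2 * wa2 E + r ^ 3 - t * wa3 E
                       - t ^ 2 - r * t * wa1 E)"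

definition good_reduction_at :: "real set \<Rightarrow> real set \<Rightarrow> weq \<Rightarrow> bool" where
  "good_reduction_at K P E \<longleftrightarrow>
     (\<exists>E'. isomorphic_over K E E' \<and>
        coeffs_in E' (localization (ring_of_integers K) P) \<and>
        wdisc E' \<in> localization (ring_of_integers K) P \<and>
        1 / wdisc E' \<in> localization (ring_of_integers K) P)"

definition everywhere_good_reduction :: "real set \<Rightarrow> weq \<Rightarrow> bool" where
  "everywhere_good_reduction K E \<longleftrightarrow>
     (\<forall>P. nonzero_prime_ideal (ring_of_integers K) P \<longrightarrow> good_reduction_at K P E)"

end

theory Submission
  imports Defs "HOL-Number_Theory.Gauss" "HOL-Library.Discrete_Functions"
begin

text \<open>
  Every admissible q can be written as c^2 + 2 a^2 with c and a odd and coprime. Put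
  \<theta> = sqrt m and d = 2 a + \<theta>, so that d has norm -2 c^2, and let E be the twist
  y^2 = x^3 + 4 d x^2 + 2 d^2 x of the curve with complex multiplication by Z[sqrt (-2)], which has
  j-invariant 20^3 and discriminant 2^9 d^6. At odd primes not dividing d this model is good. At odd
  primes dividing d the conjugate of d is a unit, and d = c^2 (-2 / (2 a - \<theta>)) shows
  that d may be replaced by a unit. At the prime over 2 the substitution u = 2, r = 2, s = \<theta>,
  t = 4 gives an integral model of discriminant (d^2 / 2)^3, provided that the sign of a is chosen
  such that a is 3 modulo 4.
\<close>

section \<open>The form \<open>x\<^sup>2 + 2 y\<^sup>2\<close>\<close>

text \<open>Prepares Gauss's lemma: for an odd prime 2h + 1 these are the doubles of 1, ..., h that
  exceed h, so their number determines the sign.\<close>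

lemma card_even_greaterThanAtMost:
  fixes h :: int
  assumes "h \<ge> 0"
  shows "card {x. even x \<and> h < x \<and> x \<le> 2 * h} = nat (h - h div 2)"
proof -
  have "{x. even x \<and> h < x \<and> x \<le> 2 * h} = (\<lambda>x. 2 * x) ` {h div 2 <.. h}"
    by (auto elim!: evenE)
  moreover have "inj_on (\<lambda>x. 2 * x) {h div 2 <.. h}"
    by (auto simp: inj_on_def)
  ultimately show ?thesis
    by (simp add: card_image)
qed

text \<open>By Gauss's lemma with multiplier 2, (-2)^h is congruent to (-1)^(h +
  \<open>card E\<close>), where h = (p - 1)/2. The exponent is even in both residue classes, and
  Euler's criterion concludes.\<close>

lemma QuadRes_minus_2:
  fixes p :: nat
  assumes p: "prime p" and mod8: "p mod 8 = 1 \<or> p mod 8 = 3"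
  shows "QuadRes p (-2)"
proof -
  have p2: "2 < p"
    using prime_ge_2_nat[OF p] mod8 by (cases "p = 2") auto
  define h where "h = (int p - 1) div 2"
  have ph: "int p = 2 * h + 1"
    using mod8 unfolding h_def by presburger
  have h0: "h > 0"
    using ph p2 by simp
  interpret GAUSS p 2
    by unfold_locales (use p p2 zdvd_not_zless[of 2 "int p"] zdvd_imp_le[of "int p" 2]
        in \<open>auto simp: cong_0_iff\<close>)
  \<comment> \<open>\<open>E\<close> collects the reduced doubles of 1, ..., h that exceed h. Since
    2h < p, no double is changed by reduction modulo p.\<close>
  have "E = {x. even x \<and> h < x \<and> x \<le> 2 * h}"
  proof -
    have "(\<lambda>x. x * 2 mod int p) ` {0<..h} = (\<lambda>x. x * 2) ` {0<..h}"
      by (rule image_cong) (auto simp: ph)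
    then have "E = (\<lambda>x. x * 2) ` {0<..h} \<inter> {h<..}"
      unfolding E_def C_def B_def A_def h_def[symmetric] image_image by simp
    also have "\<dots> = {x. even x \<and> h < x \<and> x \<le> 2 * h}"
    proof (intro equalityI subsetI)
      fix x assume "x \<in> {x. even x \<and> h < x \<and> x \<le> 2 * h}"
      then show "x \<in> (\<lambda>x. x * 2) ` {0<..h} \<inter> {h<..}"
        using h0 by (auto intro!: image_eqI[of _ _ "x div 2"])
    qed auto
    finally show ?thesis .
  qed
  then have cardE: "card E = nat (h - h div 2)"
    using card_even_greaterThanAtMost h0 by simp
  have "even (nat h + card E)"
    using mod8
  proof
    assume "p mod 8 = 1"
    then have "h mod 4 = 0" using ph by presburger
    then show ?thesis unfolding cardE using h0 by (simp add: even_nat_iff) presburger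
  next
    assume "p mod 8 = 3"
    then have "h mod 4 = 1" using ph by presburger
    then show ?thesis unfolding cardE using h0 by (simp add: even_nat_iff) presburger
  qed
  then have 1: "(-1) ^ nat h * (-1) ^ card E = (1::int)"
    by (simp flip: power_add)
  have "(-2) ^ nat h = (-1) ^ nat h * (2::int) ^ nat h"
    by (simp flip: power_mult_distrib)
  moreover have "[(-1) ^ nat h * 2 ^ nat h = (-1) ^ nat h * (-1) ^ card E] (mod int p)"
    using pre_gauss_lemma unfolding h_def[symmetric] by (rule cong_scalar_left)
  moreover have "(p - 1) div 2 = nat h"
    using ph by linarith
  ultimately have "[Legendre (-2) p = 1] (mod int p)"
    using euler_criterion[OF p p2, of "-2"] 1 by (auto intro: cong_trans)
  \<comment> \<open>The other values 0 and -1 of the Legendre symbol would make p divide 1 or 2, but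
    p > 2.\<close>
  then show ?thesis
    using p2 unfolding Legendre_def
    by (auto simp: cong_iff_dvd_diff split: if_splits dest!: zdvd_imp_le)
qed

text \<open>Thue's argument: if k^2 is -2 modulo p, pigeonhole yields a small nonzero pair with x
  congruent to k y. Then x^2 + 2 y^2 is a positive multiple of p below 3p.\<close>

lemma prime_eq_square_plus_2_square:
  fixes p :: nat
  assumes p: "prime p" and mod8: "p mod 8 = 1 \<or> p mod 8 = 3"
  shows "\<exists>c a :: int. int p = c\<^sup>2 + 2 * a\<^sup>2"
proof -
  obtain k :: int where k: "[k\<^sup>2 = -2] (mod int p)"
    using QuadRes_minus_2[OF assms] unfolding QuadRes_def by blast
  have p0: "int p > 0" using p prime_gt_0_nat by simp
  \<comment> \<open>With this s the box \<open>X\<close> has (s + 1)^2 > p points, so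
    \<open>f\<close> must collide on it. As p is not a square, s^2 < p is strict, which later
    excludes the multiple 3p.\<close>
  define s where "s = floor_sqrt p"
  have s1: "s\<^sup>2 < p"
  proof -
    have "s\<^sup>2 \<noteq> p" using p prime_power_iff[of s 2] by (auto simp: prime_power_iff)
    then show ?thesis unfolding s_def using floor_sqrt_power2_le[of p] by linarith
  qed
  have s2: "p < (Suc s)\<^sup>2"
    unfolding s_def by (rule Suc_floor_sqrt_power2_gt)
  define X where "X = {0..int s} \<times> {0..int s}"
  define f where "f = (\<lambda>(x, y). (x - k * y) mod int p)"
  have "\<not> inj_on f X"
  proof
    assume "inj_on f X"
    then have "card (f ` X) = (Suc s)\<^sup>2"
      by (simp add: card_image X_def power2_eq_square nat_add_distrib)
    moreover have "f ` X \<subseteq> {0..<int p}"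
      using p0 by (auto simp: f_def)
    then have "card (f ` X) \<le> card {0..<int p}"
      by (intro card_mono) auto
    ultimately show False using s2 by simp
  qed
  then obtain x1 y1 x2 y2 where xy: "(x1, y1) \<in> X" "(x2, y2) \<in> X"
    "f (x1, y1) = f (x2, y2)" "(x1, y1) \<noteq> (x2, y2)"
    unfolding inj_on_def by fast
  define x y where "x = x1 - x2" and "y = y1 - y2"
  have bd: "\<bar>x\<bar> \<le> int s" "\<bar>y\<bar> \<le> int s"
    using xy by (auto simp: x_def y_def X_def)
  have nz: "x \<noteq> 0 \<or> y \<noteq> 0"
    using xy by (auto simp: x_def y_def)
  have "int p dvd x - k * y"
    using xy(3) unfolding f_def x_def y_def
    by (simp add: mod_eq_dvd_iff algebra_simps)
  then have "int p dvd (x - k * y) * (x + k * y)"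
    by simp
  moreover have "int p dvd k\<^sup>2 + 2"
    using k by (simp add: cong_iff_dvd_diff)
  then have "int p dvd (k\<^sup>2 + 2) * y\<^sup>2"
    by simp
  ultimately have "int p dvd (x - k * y) * (x + k * y) + (k\<^sup>2 + 2) * y\<^sup>2"
    by (rule dvd_add)
  also have "\<dots> = x\<^sup>2 + 2 * y\<^sup>2"
    by (simp add: algebra_simps power2_eq_square)
  finally obtain n where n: "x\<^sup>2 + 2 * y\<^sup>2 = int p * n" by blast
  have "x\<^sup>2 \<le> (int s)\<^sup>2" "y\<^sup>2 \<le> (int s)\<^sup>2"
    using bd by (metis abs_le_square_iff abs_of_nat)+
  moreover have "(int s)\<^sup>2 < int p"
    using s1 by (metis of_nat_less_iff of_nat_power)
  ultimately have "int p * n < int p * 3"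
    unfolding n[symmetric] by linarith
  then have "n < 3" using p0 by (simp add: mult_less_cancel_left_pos)
  moreover have "x\<^sup>2 + 2 * y\<^sup>2 > 0"
    using nz by (smt (verit) zero_less_power2 zero_le_power2)
  then have "n > 0" using n p0 by (simp add: zero_less_mult_iff)
  ultimately consider "n = 1" | "n = 2" by linarith
  then show ?thesis
  proof cases
    case 1
    then show ?thesis using n by (metis mult.right_neutral)
  next
    \<comment> \<open>From x^2 + 2 y^2 = 2p, x is even; putting x = 2z and halving exchanges the
      roles of the two squares.\<close>
    case 2
    then have "even (x\<^sup>2)"
      using n by (metis dvd_add_left_iff dvd_triv_left dvd_triv_right)
    then obtain z where "x = 2 * z" by (auto elim: evenE)
    then have "int p = y\<^sup>2 + 2 * z\<^sup>2"
      using n 2 by (simp add: power2_eq_square)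
    then show ?thesis by blast
  qed
qed

text \<open>The form is the norm from Z[sqrt(-2)], hence multiplicative, so the prime case
  suffices.\<close>

lemma eq_square_plus_2_square:
  fixes n :: nat
  assumes "n > 0" and "\<forall>p\<in>prime_factors n. p mod 8 = 1 \<or> p mod 8 = 3"
  shows "\<exists>c a :: int. int n = c\<^sup>2 + 2 * a\<^sup>2"
  using assms
proof (induction n rule: prime_divisors_induct)
  case (unit n)
  then show ?case by (auto intro: exI[of _ 1] exI[of _ 0])
next
  case (factor p n)
  then have n0: "n > 0" and p: "prime p" by auto
  have pf: "prime_factors (p * n) = insert p (prime_factors n)"
    using n0 p by (subst prime_factors_product) (auto simp: prime_factorization_prime)
  obtain c a :: int where n: "int n = c\<^sup>2 + 2 * a\<^sup>2"
    using factor n0 pf by auto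
  obtain c' a' :: int where p: "int p = c'\<^sup>2 + 2 * a'\<^sup>2"
    using prime_eq_square_plus_2_square[OF p] factor pf by auto
  \<comment> \<open>The new pair consists of the coordinates of (c' + a' sqrt(-2)) (c + a
    sqrt(-2)).\<close>
  have "int (p * n) = (c' * c - 2 * a' * a)\<^sup>2 + 2 * (c' * a + a' * c)\<^sup>2"
    unfolding of_nat_mult n p by (simp add: algebra_simps power2_eq_square)
  then show ?case by blast
qed simp

section \<open>The order \<open>\<int>[\<surd>m]\<close>\<close>

text \<open>Supplies integral elements with explicit coordinates. Integrality checks below become
  membership in this order, which is then transferred to the ring of integers by inclusion.\<close>

definition quad_order :: "nat \<Rightarrow> real set" where
  "quad_order m = {of_int x + of_int y * sqrt (real m) | x y. True}"

lemma quad_orderI: "of_int x + of_int y * sqrt (real m) \<in> quad_order m"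
  unfolding quad_order_def by blast

lemma quad_orderE:
  assumes "z \<in> quad_order m"
  obtains x y where "z = of_int x + of_int y * sqrt (real m)"
  using assms unfolding quad_order_def by blast

lemma quad_order_of_int [intro, simp]: "of_int x \<in> quad_order m"
  using quad_orderI[of x 0 m] by simp

lemma quad_order_numeral [intro, simp]: "numeral k \<in> quad_order m"
  using quad_order_of_int[of "numeral k" m] by simp

lemma quad_order_0 [intro, simp]: "0 \<in> quad_order m"
  using quad_order_of_int[of 0 m] by simp

lemma quad_order_1 [intro, simp]: "1 \<in> quad_order m"
  using quad_order_of_int[of 1 m] by simp

lemma quad_order_sqrt [intro, simp]: "sqrt (real m) \<in> quad_order m"
  using quad_orderI[of 0 1 m] by simp

lemma quad_order_add [intro]:
  assumes "x \<in> quad_order m" "y \<in> quad_order m"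
  shows "x + y \<in> quad_order m"
proof -
  obtain a b a' b' where "x = of_int a + of_int b * sqrt (real m)"
    "y = of_int a' + of_int b' * sqrt (real m)"
    using assms by (metis quad_orderE)
  then have "x + y = of_int (a + a') + of_int (b + b') * sqrt (real m)"
    by (simp add: algebra_simps)
  then show ?thesis by (metis quad_orderI)
qed

lemma quad_order_mult [intro]:
  assumes "x \<in> quad_order m" "y \<in> quad_order m"
  shows "x * y \<in> quad_order m"
proof -
  obtain a b a' b' where "x = of_int a + of_int b * sqrt (real m)"
    "y = of_int a' + of_int b' * sqrt (real m)"
    using assms by (metis quad_orderE)
  then have "x * y = of_int (a * a' + int m * b * b') + of_int (a * b' + a' * b) * sqrt (real m)"
    by (simp add: algebra_simps)
  then show ?thesis by (metis quad_orderI)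
qed

lemma quad_order_uminus [intro]: "x \<in> quad_order m \<Longrightarrow> - x \<in> quad_order m"
  using quad_order_mult[OF quad_order_of_int[of "-1"]] by simp

lemma quad_order_diff [intro]:
  "x \<in> quad_order m \<Longrightarrow> y \<in> quad_order m \<Longrightarrow> x - y \<in> quad_order m"
  using quad_order_add[OF _ quad_order_uminus, of x m y] by simp

lemma quad_order_power [intro]: "x \<in> quad_order m \<Longrightarrow> x ^ n \<in> quad_order m"
  by (induction n) auto

lemma quad_order_subset_quad_field: "quad_order m \<subseteq> quad_field m"
proof
  fix z assume "z \<in> quad_order m"
  then obtain x y where "z = of_int x + of_int y * sqrt (real m)" by (rule quad_orderE)
  then have "z = of_rat (of_int x) + of_rat (of_int y) * sqrt (real m)" by simp
  then show "z \<in> quad_field m" unfolding quad_field_def by blast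
qed

lemma quad_order_subset_integers: "quad_order m \<subseteq> ring_of_integers (quad_field m)"
proof
  fix z assume z: "z \<in> quad_order m"
  then obtain x y where xy: "z = of_int x + of_int y * sqrt (real m)" by (rule quad_orderE)
  \<comment> \<open>The polynomial whose roots are z and its conjugate: norm, negated trace,
    1.\<close>
  let ?p = "[: x\<^sup>2 - int m * y\<^sup>2, - 2 * x, 1 :]"
  have "poly (map_poly of_int ?p) z = 0"
    unfolding xy by (simp add: map_poly_pCons algebra_simps power2_eq_square)
  moreover have "lead_coeff ?p = 1" by simp
  ultimately show "z \<in> ring_of_integers (quad_field m)"
    using z quad_order_subset_quad_field unfolding ring_of_integers_def by blast
qed

section \<open>Prime ideals\<close>

lemma nonzero_prime_ideal_1_notin:
  assumes "nonzero_prime_ideal R P"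
  shows "1 \<notin> P"
  using assms unfolding nonzero_prime_ideal_def by (metis mult.right_neutral subsetI subset_antisym)

lemma nonzero_prime_ideal_add:
  "nonzero_prime_ideal R P \<Longrightarrow> x \<in> P \<Longrightarrow> y \<in> P \<Longrightarrow> x + y \<in> P"
  unfolding nonzero_prime_ideal_def by blast

lemma nonzero_prime_ideal_mult:
  "nonzero_prime_ideal R P \<Longrightarrow> a \<in> R \<Longrightarrow> x \<in> P \<Longrightarrow> a * x \<in> P"
  unfolding nonzero_prime_ideal_def by blast

lemma nonzero_prime_ideal_prime:
  "nonzero_prime_ideal R P \<Longrightarrow> a \<in> R \<Longrightarrow> b \<in> R \<Longrightarrow> a * b \<in> P \<Longrightarrow> a \<in> P \<or> b \<in> P"
  unfolding nonzero_prime_ideal_def by blast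

lemma quad_order_mult_notin:
  assumes "nonzero_prime_ideal (ring_of_integers (quad_field m)) P"
    and "a \<in> quad_order m" "b \<in> quad_order m" "a \<notin> P" "b \<notin> P"
  shows "a * b \<notin> P"
  using assms nonzero_prime_ideal_prime quad_order_subset_integers by blast

lemma quad_order_power_notin:
  assumes "nonzero_prime_ideal (ring_of_integers (quad_field m)) P"
    and "a \<in> quad_order m" "a \<notin> P"
  shows "a ^ n \<notin> P"
  by (induction n)
     (use assms nonzero_prime_ideal_1_notin[OF assms(1)] in \<open>auto dest: quad_order_mult_notin\<close>)

lemma quad_order_divide_localization:
  assumes "a \<in> quad_order m" "b \<in> quad_order m" "b \<notin> P"
  shows "a / b \<in> localization (ring_of_integers (quad_field m)) P"
  using assms quad_order_subset_integers unfolding localization_def by blast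

lemma quad_order_localization:
  assumes "nonzero_prime_ideal (ring_of_integers (quad_field m)) P" and "a \<in> quad_order m"
  shows "a \<in> localization (ring_of_integers (quad_field m)) P"
  using quad_order_divide_localization[of a m 1 P] assms nonzero_prime_ideal_1_notin by simp

text \<open>A Bezout combination would put 1 into P.\<close>

lemma coprime_ints_not_both_in:
  fixes a c :: int
  assumes P: "nonzero_prime_ideal (ring_of_integers (quad_field m)) P"
    and "coprime a c"
  shows "\<not> (of_int a \<in> P \<and> of_int c \<in> P)"
proof
  assume *: "of_int a \<in> P \<and> of_int c \<in> P"
  obtain u v where "u * a + v * c = 1"
    using bezout_int[of a c] assms(2) by auto
  then have "of_int u * of_int a + of_int v * of_int c = (1::real)"
    by (metis of_int_1 of_int_add of_int_mult)
  moreover have "of_int u * of_int a + of_int v * of_int c \<in> P"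
    using * P quad_order_subset_integers
    by (blast intro: nonzero_prime_ideal_add nonzero_prime_ideal_mult)
  ultimately show False
    using nonzero_prime_ideal_1_notin[OF P] by simp
qed

section \<open>Twists of the curve with complex multiplication by \<open>\<int>[\<surd>(-2)]\<close>\<close>

definition cm_twist :: "real \<Rightarrow> weq" where
  "cm_twist d = Weq 0 (4 * d) 0 (2 * d\<^sup>2) 0"

lemmas weq_invariant_defs = wdisc_def wb2_def wb4_def wb6_def wb8_def

lemma wdisc_cm_twist: "wdisc (cm_twist d) = 512 * d ^ 6"
  unfolding cm_twist_def weq_invariant_defs by (simp add: algebra_simps power_numeral_reduce)

lemma j_invariant_cm_twist:
  assumes "d \<noteq> 0"
  shows "j_invariant (cm_twist d) = 20 ^ 3"
proof -
  have "wc4 (cm_twist d) = 160 * d\<^sup>2"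
    unfolding wc4_def cm_twist_def wb2_def wb4_def by (simp add: algebra_simps power_numeral_reduce)
  then show ?thesis
    unfolding j_invariant_def wdisc_cm_twist using assms
    by (simp add: field_simps flip: power_mult)
qed

text \<open>Twists depend only on d modulo squares: this is pure scaling, with r = s = t =
  0.\<close>

lemma isomorphic_over_cm_twist:
  assumes "u \<in> K" "0 \<in> K" "u \<noteq> 0"
  shows "isomorphic_over K (cm_twist (u\<^sup>2 * d)) (cm_twist d)"
  unfolding isomorphic_over_def cm_twist_def
  by (rule bexI[of _ u], intro bexI[of _ 0])
     (use assms in \<open>auto simp: power_mult_distrib simp flip: power_mult\<close>)

text \<open>The transform of \<open>cm_twist d\<close> under u = 2, r = 2, s = \<open>\<theta>\<close>, t = 4.\<close>

definition dyadic_model :: "real \<Rightarrow> real \<Rightarrow> weq" where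
  "dyadic_model \<theta> d =
     Weq \<theta> (d + (6 - \<theta>\<^sup>2) / 4) 1 (d + (d\<^sup>2 / 2 + 3 - 2 * \<theta>) / 4) ((d\<^sup>2 / 2 + 2 * d - 1) / 8)"

text \<open>The substitution divides the discriminant 2^9 d^6 by u^12 = 2^12.\<close>

lemma wdisc_dyadic_model: "wdisc (dyadic_model \<theta> d) = (d\<^sup>2 / 2) ^ 3"
  unfolding dyadic_model_def weq_invariant_defs
  by (simp add: field_simps power_numeral_reduce)

lemma isomorphic_over_dyadic_model:
  assumes "2 \<in> K" "4 \<in> K" "\<theta> \<in> K"
  shows "isomorphic_over K (cm_twist d) (dyadic_model \<theta> d)"
  unfolding isomorphic_over_def cm_twist_def dyadic_model_def
  by (rule bexI[of _ 2], rule bexI[of _ 2], rule bexI[of _ \<theta>], rule bexI[of _ 4])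
     (use assms in \<open>auto simp: field_simps power_numeral_reduce\<close>)

section \<open>Choice of the twist and good reduction prime by prime\<close>

theorem theorem1p3:
  fixes q m :: nat
  assumes "squarefree q"
    and "\<forall>p \<in> prime_factors q. p mod 8 = 1 \<or> p mod 8 = 3"
    and "q mod 8 = 3"
    and "m = 2 * q"
  shows "\<exists>E. elliptic_curve_over (quad_field m) E
             \<and> everywhere_good_reduction (quad_field m) E
             \<and> j_invariant E = 20 ^ 3"
proof -
  have "q > 0" using assms(3) by (cases "q = 0") auto
  then obtain c b :: int where qb: "int q = c\<^sup>2 + 2 * b\<^sup>2"
    using eq_square_plus_2_square assms(2) by blast
  have "odd (int q)"
    using assms(3) by presburger
  then have "odd c"
    unfolding qb by simp
  have "odd b"
  \<comment> \<open>An even b would give q congruent to c^2, hence to 1, modulo 4.\<close>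
  proof
    assume "even b"
    then obtain b' where "b = 2 * b'" by blast
    moreover obtain c' where "c = 2 * c' + 1" using \<open>odd c\<close> by (blast elim: oddE)
    ultimately have "int q = 4 * (c'\<^sup>2 + c' + 2 * b'\<^sup>2) + 1"
      unfolding qb by (simp add: algebra_simps power2_eq_square)
    then have "int q mod 4 = 1" by presburger
    then show False using assms(3) by presburger
  qed
  \<comment> \<open>As b is odd, exactly one of b and -b is 3 modulo 4. This choice makes the
    coefficient (a + 1)/4 of \<theta> in \<open>wa6\<close> of the dyadic model an integer.\<close>
  define a where "a = (if b mod 4 = 3 then b else - b)"
  have a4: "a mod 4 = 3"
    using \<open>odd b\<close> unfolding a_def by (auto simp: zmod_zminus1_eq_if) presburger+
  have qa: "int q = c\<^sup>2 + 2 * a\<^sup>2"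
    using qb unfolding a_def by simp
  \<comment> \<open>The square of a common divisor of a and c divides the squarefree q.\<close>
  have "coprime a c"
  proof (rule coprimeI)
    fix g assume "g dvd a" "g dvd c"
    then have "g\<^sup>2 dvd int q"
      unfolding qa by (intro dvd_add dvd_mult) (auto simp: dvd_power_same)
    then have "(nat \<bar>g\<bar>)\<^sup>2 dvd q"
      by (metis int_dvd_int_iff int_nat_eq abs_ge_zero of_nat_power power2_abs nat_0_le)
    then show "is_unit g"
      using assms(1) unfolding squarefree_def by force
  qed
  define \<theta> where "\<theta> = sqrt (real m)"
  define d where "d = 2 * of_int a + \<theta>"
  define d' where "d' = 2 * of_int a - \<theta>"
  define K where "K = quad_field m"
  define R where "R = ring_of_integers K"
  have th2: "\<theta>\<^sup>2 = 2 * real q"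
    unfolding \<theta>_def assms(4) by simp
  have qr: "real q = of_int c ^ 2 + 2 * of_int a ^ 2"
    using qa by (metis of_int_add of_int_mult of_int_numeral of_int_of_nat_eq of_int_power)
  have c0: "real_of_int c \<noteq> 0"
    using \<open>odd c\<close> by auto
  have "d * d' = 4 * of_int a ^ 2 - \<theta>\<^sup>2"
    unfolding d_def d'_def by (simp add: algebra_simps power2_eq_square)
  \<comment> \<open>Since \<theta>^2 = 2q = 2 c^2 + 4 a^2, the terms in a cancel.\<close>
  then have norm_d: "d * d' = - 2 * of_int c ^ 2"
    unfolding th2 qr by simp
  then have d0: "d \<noteq> 0" and d'0: "d' \<noteq> 0"
    using c0 by auto
  have SK: "quad_order m \<subseteq> K"
    unfolding K_def by (rule quad_order_subset_quad_field)
  have thS: "\<theta> \<in> quad_order m" and dS: "d \<in> quad_order m" and d'S: "d' \<in> quad_order m"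
    unfolding d_def d'_def \<theta>_def by auto
  have "good_reduction_at K P (cm_twist d)" if "nonzero_prime_ideal R P" for P
  proof -
    have P: "nonzero_prime_ideal (ring_of_integers (quad_field m)) P"
      using that unfolding R_def K_def .
    note loc = quad_order_localization[OF P, folded K_def]
    note loc_div = quad_order_divide_localization[of _ m _ P, folded K_def]
    note notin = quad_order_mult_notin[OF P] quad_order_power_notin[OF P]
    have SR: "quad_order m \<subseteq> ring_of_integers (quad_field m)"
      by (rule quad_order_subset_integers)
    show ?thesis
    proof (cases "2 \<in> P")
      case False
      have 2: "2 ^ n \<notin> P" for n
        using False notin(2)[of 2] by auto
      show ?thesis
      proof (cases "d \<in> P")
        case False
        have "512 * d ^ 6 \<notin> P"
          using notin 2[of 9] False dS by auto
        then have "1 / wdisc (cm_twist d) \<in> localization (ring_of_integers K) P"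
          unfolding wdisc_cm_twist using dS by (intro loc_div) auto
        moreover have "wdisc (cm_twist d) \<in> localization (ring_of_integers K) P"
          unfolding wdisc_cm_twist using dS by (intro loc) auto
        moreover have "coeffs_in (cm_twist d) (localization (ring_of_integers K) P)"
          unfolding coeffs_in_def cm_twist_def using dS by (auto intro!: loc)
        moreover have "isomorphic_over K (cm_twist d) (cm_twist d)"
          using isomorphic_over_cm_twist[of 1 K d] SK by auto
        ultimately show ?thesis
          unfolding good_reduction_at_def by blast
      next
        case True
        \<comment> \<open>If P contained both conjugates, it would contain their sum 4a and their
          product -2 c^2. As 2 is not in P, both a and c would lie in P, against
          coprimality.\<close>
        have d'P: "d' \<notin> P"
        proof
          assume "d' \<in> P"
          then have "d + d' \<in> P"
            using nonzero_prime_ideal_add[OF P] True by blast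
          moreover have "d + d' = 2 ^ 2 * of_int a"
            unfolding d_def d'_def by simp
          ultimately have "of_int a \<in> P"
            using notin(1)[of "2 ^ 2" "of_int a"] 2[of 2] by auto
          have "(- d') * d \<in> P"
            using nonzero_prime_ideal_mult[OF P _ True] d'S SR by blast
          moreover have "(- d') * d = 2 * of_int c ^ 2"
            using norm_d by (simp add: mult.commute)
          ultimately have "of_int c \<in> P"
            using notin(1)[of 2 "of_int c ^ 2"] notin(2)[of "of_int c" 2] \<open>2 \<notin> P\<close> by auto
          then show False
            using coprime_ints_not_both_in[OF P \<open>coprime a c\<close>] \<open>of_int a \<in> P\<close> by blast
        qed
        \<comment> \<open>At P both 2 and d' are units, hence so is e; and d differs from e only by
          the square c^2.\<close>
        define e where "e = - 2 / d'"
        have "d = of_int c ^ 2 * e"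
          unfolding e_def using norm_d d'0 by (simp add: field_simps)
        then have "isomorphic_over K (cm_twist d) (cm_twist e)"
          using isomorphic_over_cm_twist[of "of_int c" K e] SK c0 by auto
        moreover have "coeffs_in (cm_twist e) (localization (ring_of_integers K) P)"
        proof -
          have "- 8 / d' \<in> localization (ring_of_integers K) P"
            using d'S d'P by (intro loc_div) auto
          then have "4 * e \<in> localization (ring_of_integers K) P"
            unfolding e_def by simp
          moreover have "8 / d'\<^sup>2 \<in> localization (ring_of_integers K) P"
            using d'S d'P notin(2) by (intro loc_div) auto
          then have "2 * e\<^sup>2 \<in> localization (ring_of_integers K) P"
            unfolding e_def by (simp add: power_divide)
          ultimately show ?thesis
            unfolding coeffs_in_def cm_twist_def by (simp add: loc)
        qed
        moreover have "wdisc (cm_twist e) \<in> localization (ring_of_integers K) P"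
        proof -
          have "wdisc (cm_twist e) = 32768 / d' ^ 6"
            unfolding wdisc_cm_twist e_def by (simp add: power_divide)
          moreover have "d' ^ 6 \<notin> P"
            using notin(2) d'S d'P by auto
          ultimately show ?thesis
            using d'S by (auto intro!: loc_div)
        qed
        moreover have "1 / wdisc (cm_twist e) \<in> localization (ring_of_integers K) P"
        proof -
          have "32768 \<notin> P"
            using 2[of 15] by simp
          then have "d' ^ 6 / 32768 \<in> localization (ring_of_integers K) P"
            using d'S by (intro loc_div) auto
          then show ?thesis
            unfolding wdisc_cm_twist e_def by (simp add: power_divide)
        qed
        ultimately show ?thesis
          unfolding good_reduction_at_def by blast
      qed
    next
      case True
      \<comment> \<open>Halving stays integral because \<theta>^2 = 2q is even.\<close>
      have D: "d\<^sup>2 / 2 = of_int (2 * a\<^sup>2 + int q) + of_int (2 * a) * \<theta>"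
        and D': "d'\<^sup>2 / 2 = of_int (2 * a\<^sup>2 + int q) - of_int (2 * a) * \<theta>"
        unfolding d_def d'_def using th2 by (simp_all add: power2_sum power2_diff power_mult_distrib)
      have DS: "d\<^sup>2 / 2 \<in> quad_order m" and D'S: "d'\<^sup>2 / 2 \<in> quad_order m"
        unfolding D D' using thS by blast+
      \<comment> \<open>The norm of d^2 / 2 is c^4, which is odd and so cannot lie in P together
        with 2. Hence the discriminant of the dyadic model is a unit at P.\<close>
      have DP: "d\<^sup>2 / 2 \<notin> P"
      proof
        assume "d\<^sup>2 / 2 \<in> P"
        then have "(d'\<^sup>2 / 2) * (d\<^sup>2 / 2) \<in> P"
          using nonzero_prime_ideal_mult[OF P] D'S SR by blast
        moreover have "(d'\<^sup>2 / 2) * (d\<^sup>2 / 2) = (d * d')\<^sup>2 / 4"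
          by (simp add: power_mult_distrib)
        then have "(d'\<^sup>2 / 2) * (d\<^sup>2 / 2) = of_int (c ^ 4)"
          unfolding norm_d by (simp add: power_mult_distrib flip: power_mult)
        ultimately have "real_of_int (c ^ 4) \<in> P" by simp
        moreover have "coprime 2 (c ^ 4)"
          using \<open>odd c\<close> by simp
        ultimately show False
          using coprime_ints_not_both_in[OF P, of 2 "c ^ 4"] True by simp
      qed
      obtain k where k: "a = 4 * k + 3"
        using a4 by (metis mult_div_mod_eq)
      obtain n where n: "int q = 8 * n + 3"
        using assms(3) by (metis mult_div_mod_eq of_nat_add of_nat_mult of_nat_numeral)
      have nr: "real q = 8 * of_int n + 3"
        using n by (metis of_int_add of_int_mult of_int_numeral of_int_of_nat_eq)
      \<comment> \<open>Here s = \<theta> pays off: \<theta>^2 = 2q is 6 modulo 16, so 6 -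
        \<theta>^2 is divisible by 4.\<close>
      have "d + (6 - \<theta>\<^sup>2) / 4 = d - of_int (4 * n)"
        unfolding th2 nr by (simp add: field_simps)
      then have a2: "d + (6 - \<theta>\<^sup>2) / 4 \<in> quad_order m"
        using dS by (metis quad_order_diff quad_order_of_int)
      have "d + (d\<^sup>2 / 2 + 3 - 2 * \<theta>) / 4
          = d + of_int (8 * k\<^sup>2 + 12 * k + 6 + 2 * n) + of_int (2 * k + 1) * \<theta>"
        unfolding D k n by (simp add: field_simps power2_eq_square)
      then have a4: "d + (d\<^sup>2 / 2 + 3 - 2 * \<theta>) / 4 \<in> quad_order m"
        using dS thS by (metis quad_order_add quad_order_mult quad_order_of_int)
      \<comment> \<open>The coefficient of \<theta> is (2a + 2)/8 = k + 1, and the rational part is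
        (2 a^2 + q + 4a - 1)/8. The former is where a congruent to 3 modulo 4 enters.\<close>
      have "(d\<^sup>2 / 2 + 2 * d - 1) / 8
          = of_int (4 * k\<^sup>2 + 8 * k + 4 + n) + of_int (k + 1) * \<theta>"
        unfolding D unfolding d_def k n by (simp add: field_simps power2_eq_square)
      then have a6: "(d\<^sup>2 / 2 + 2 * d - 1) / 8 \<in> quad_order m"
        using thS by (metis quad_order_add quad_order_mult quad_order_of_int)
      have "coeffs_in (dyadic_model \<theta> d) (localization (ring_of_integers K) P)"
        unfolding coeffs_in_def dyadic_model_def using thS a2 a4 a6 by (simp add: loc)
      moreover have "wdisc (dyadic_model \<theta> d) \<in> localization (ring_of_integers K) P"
        unfolding wdisc_dyadic_model using DS by (intro loc) auto
      moreover have "1 / wdisc (dyadic_model \<theta> d) \<in> localization (ring_of_integers K) P"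
        unfolding wdisc_dyadic_model using DS DP notin(2) by (intro loc_div) auto
      moreover have "isomorphic_over K (cm_twist d) (dyadic_model \<theta> d)"
        by (rule isomorphic_over_dyadic_model) (use SK thS in auto)
      ultimately show ?thesis
        unfolding good_reduction_at_def by blast
    qed
  qed
  then have "everywhere_good_reduction K (cm_twist d)"
    unfolding everywhere_good_reduction_def R_def by blast
  moreover have "elliptic_curve_over K (cm_twist d)"
  proof -
    have "4 * d \<in> quad_order m" "2 * d\<^sup>2 \<in> quad_order m" "0 \<in> quad_order m"
      using dS by auto
    then show ?thesis
      unfolding elliptic_curve_over_def coeffs_in_def wdisc_cm_twist
      using SK d0 by (auto simp: cm_twist_def)
  qed
  ultimately show ?thesis
    using j_invariant_cm_twist[OF d0] unfolding K_def by blast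
qed

end
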